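(* Let $(X,d)$ be a metric space and let $F=(a_0,a_1)$ with $a_0,a_1\in X$ and $\ell=|F|=d(a_0,a_1)>0$. Then for every integer $n$ the natural map $H_n^F(X)\to H_n^{\Sigma,\ell}(X)$ is injective.
   Context: Let $(X,d)$ be a metric space. For $x,y,z\in X$ write $x\prec y\prec z$ if $d(x,y)+d(y,z)=d(x,z)$, $x\neq y$ and $y\neq z$. A tuple $\boldsymbol{x}=(x_0,\dots,x_n)\in X^{n+1}$ is a proper chain of degree $n$ if $x_{i-1}\neq x_i$ for all $i=1,\dots,n$; its length is $|\boldsymbol{x}|=\sum_{i=1}^n d(x_{i-1},x_i)$. $P_n(X)$ is the set of proper chains of degree $n$, and $P_n^{\ell}(X)$ is the set of those of length $\ell$. The magnitude chain complex in grading $\ell$ is $B_n^{\ell}(X)=\bigoplus_{\boldsymbol{x}\in P_n^{\ell}(X)}\mathbb{Z}\cdot\langle\boldsymbol{x}\rangle$ with boundary $\partial_n=\sum_i(-1)^i\partial_{n,i}$, where $\partial_{n,i}\langle x_0,\dots,x_n\rangle=\langle x_0,\dots,\widehat{x_i},\dots,x_n\rangle$ if $1\le i\le n-1$ and $x_{i-1}\prec x_i\prec x_{i+1}$, and $0$ otherwise. Its homology is the magnitude homology $H_n^{\Sigma,\ell}(X)$. For $\boldsymbol{x}=(x_0,\dots,x_n)\in P_n(X)$, the point $x_i$ is smooth if $1\le i\le n-1$ and $x_{i-1}\prec x_i\prec x_{i+1}$, and singular otherwise. The frame $\varphi(\boldsymbol{x})$ is the tuple of all singular points of $\boldsymbol{x}$,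 in order. For $F\in P_m(X)$, set $P_n^F(X)=\{\boldsymbol{x}\in P_n^{|F|}(X)\mid\varphi(\boldsymbol{x})=F\}$ and $B_n^F(X)=\bigoplus_{\boldsymbol{x}\in P_n^F(X)}\mathbb{Z}\cdot\langle\boldsymbol{x}\rangle$ (which is $0$ if $P_n^F(X)=\emptyset$). $B_\bullet^F(X)$ is a subcomplex of $B_\bullet^{|F|}(X)$, and $H_n^F(X):=H_n(B_\bullet^F(X))$. The natural map $H_n^F(X)\to H_n^{\Sigma,|F|}(X)$ is the one induced by the inclusion $B_\bullet^F(X)\subset B_\bullet^{|F|}(X)$. *)

theory Defs
  imports Complex_Main "HOL-Algebra.Free_Abelian_Groups"
begin

definition strictly_between :: "'a::metric_space \<Rightarrow> 'a \<Rightarrow> 'a \<Rightarrow> bool" where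
  "strictly_between x y z \<longleftrightarrow> dist x y + dist y z = dist x z \<and> x \<noteq> y \<and> y \<noteq> z"

(* A tuple (x_0, ..., x_n) is the list [x_0, ..., x_n], of length n + 1.  Degrees are integers; the
   condition xs \<noteq> [] leaves no chain in degree -1 (nor in any other negative degree). *)

definition proper_chains :: "int \<Rightarrow> 'a::metric_space list set" where
  "proper_chains n =
     {xs. xs \<noteq> [] \<and> int (length xs) = n + 1 \<and> (\<forall>i\<in>{1..<length xs}. xs ! (i - 1) \<noteq> xs ! i)}"

definition chain_length :: "'a::metric_space list \<Rightarrow> real" where
  "chain_length xs = (\<Sum>i = 1..<length xs. dist (xs ! (i - 1)) (xs ! i))"

definition proper_chains_of_length :: "real \<Rightarrow> int \<Rightarrow> 'a::metric_space list set" where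
  "proper_chains_of_length l n = {xs \<in> proper_chains n. chain_length xs = l}"

(* Smoothness concerns the position i, since a point may occur several times in a chain. *)

definition smooth_at :: "'a::metric_space list \<Rightarrow> nat \<Rightarrow> bool" where
  "smooth_at xs i \<longleftrightarrow>
     1 \<le> i \<and> i + 1 < length xs \<and> strictly_between (xs ! (i - 1)) (xs ! i) (xs ! (i + 1))"

definition chain_frame :: "'a::metric_space list \<Rightarrow> 'a list" where
  "chain_frame xs = nths xs {i. \<not> smooth_at xs i}"

definition framed_chains :: "'a::metric_space list \<Rightarrow> int \<Rightarrow> 'a list set" where
  "framed_chains F n = {xs \<in> proper_chains_of_length (chain_length F) n. chain_frame xs = F}"

definition magnitude_face :: "nat \<Rightarrow> 'a::metric_space list \<Rightarrow> 'a list \<Rightarrow>\<^sub>0 int" where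
  "magnitude_face i xs =
     (if smooth_at xs i then frag_of (take i xs @ drop (i + 1) xs) else 0)"

definition magnitude_boundary :: "('a::metric_space list \<Rightarrow>\<^sub>0 int) \<Rightarrow> ('a list \<Rightarrow>\<^sub>0 int)" where
  "magnitude_boundary =
     frag_extend (\<lambda>xs. \<Sum>i<length xs. frag_cmul ((-1) ^ i) (magnitude_face i xs))"

(* In the following, P assigns to every degree n the basis P n of the n-th chain group; the
   differential is the magnitude boundary. *)

abbreviation chain_group :: "(int \<Rightarrow> 'a list set) \<Rightarrow> int \<Rightarrow> ('a list \<Rightarrow>\<^sub>0 int) monoid" where
  "chain_group P n \<equiv> free_Abelian_group (P n)"

definition cycles :: "(int \<Rightarrow> 'a::metric_space list set) \<Rightarrow> int \<Rightarrow> ('a list \<Rightarrow>\<^sub>0 int) set" where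
  "cycles P n = kernel (chain_group P n) (chain_group P (n - 1)) magnitude_boundary"

definition boundaries :: "(int \<Rightarrow> 'a::metric_space list set) \<Rightarrow> int \<Rightarrow> ('a list \<Rightarrow>\<^sub>0 int) set" where
  "boundaries P n = magnitude_boundary ` carrier (chain_group P (n + 1))"

definition chain_homology ::
    "(int \<Rightarrow> 'a::metric_space list set) \<Rightarrow> int \<Rightarrow> ('a list \<Rightarrow>\<^sub>0 int) set monoid" where
  "chain_homology P n = (chain_group P n)\<lparr>carrier := cycles P n\<rparr> Mod boundaries P n"

definition magnitude_homology ::
    "real \<Rightarrow> int \<Rightarrow> ('a::metric_space list \<Rightarrow>\<^sub>0 int) set monoid" where
  "magnitude_homology l = chain_homology (proper_chains_of_length l)"

definition frame_homology ::
    "'a::metric_space list \<Rightarrow> int \<Rightarrow> ('a list \<Rightarrow>\<^sub>0 int) set monoid" where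
  "frame_homology F = chain_homology (framed_chains F)"

(* A homology class C is a coset; it goes to the class, modulo the boundaries of the target complex,
   of any z \<in> C.  The class does not depend on z: see natural_map_class. *)

definition natural_map ::
    "'a::metric_space list \<Rightarrow> int \<Rightarrow> ('a list \<Rightarrow>\<^sub>0 int) set \<Rightarrow> ('a list \<Rightarrow>\<^sub>0 int) set" where
  "natural_map F n C =
     (let P = proper_chains_of_length (chain_length F)
      in the_elem ((\<lambda>z. boundaries P n #>\<^bsub>chain_group P n\<^esub> z) ` C))"

lemma chain_length_pair [simp]: "chain_length [a, b] = dist a b"
  by (simp add: chain_length_def)

lemma boundaries_add:
  assumes "a \<in> boundaries P n" "b \<in> boundaries P n"
  shows "a + b \<in> boundaries P n"
proof -
  obtain c d where c: "Poly_Mapping.keys c \<subseteq> P (n + 1)" "a = magnitude_boundary c"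
    and d: "Poly_Mapping.keys d \<subseteq> P (n + 1)" "b = magnitude_boundary d"
    using assms unfolding boundaries_def by auto
  have "a + b = magnitude_boundary (c + d)"
    unfolding c d magnitude_boundary_def by (simp only: frag_extend_add)
  moreover have "c + d \<in> carrier (chain_group P (n + 1))"
    using keys_add[of c d] c(1) d(1) unfolding carrier_free_Abelian_group_iff by blast
  ultimately show ?thesis unfolding boundaries_def by (rule image_eqI)
qed

lemma boundaries_diff:
  assumes "a \<in> boundaries P n" "b \<in> boundaries P n"
  shows "a - b \<in> boundaries P n"
proof -
  obtain c d where c: "Poly_Mapping.keys c \<subseteq> P (n + 1)" "a = magnitude_boundary c"
    and d: "Poly_Mapping.keys d \<subseteq> P (n + 1)" "b = magnitude_boundary d"
    using assms unfolding boundaries_def by auto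
  have "a - b = magnitude_boundary (c - d)"
    unfolding c d magnitude_boundary_def by (simp only: frag_extend_diff)
  moreover have "c - d \<in> carrier (chain_group P (n + 1))"
    using keys_diff[of c d] c(1) d(1) unfolding carrier_free_Abelian_group_iff by blast
  ultimately show ?thesis unfolding boundaries_def by (rule image_eqI)
qed

lemma zero_boundaries: "0 \<in> boundaries P n"
proof -
  have "0 = magnitude_boundary 0"
    unfolding magnitude_boundary_def by (simp only: frag_extend_0)
  moreover have "0 \<in> carrier (chain_group P (n + 1))" by simp
  ultimately show ?thesis unfolding boundaries_def by (rule image_eqI)
qed

lemma framed_chains_subset: "framed_chains F n \<subseteq> proper_chains_of_length (chain_length F) n"
  by (auto simp: framed_chains_def)

lemma framed_boundaries_subset:
  "boundaries (framed_chains F) n \<subseteq> boundaries (proper_chains_of_length (chain_length F)) n"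
  unfolding boundaries_def
  by (rule image_mono) (use framed_chains_subset[of F "n + 1"] in \<open>auto simp only: carrier_free_Abelian_group_iff\<close>)

lemma framed_cycles_subset:
  "cycles (framed_chains F) n \<subseteq> cycles (proper_chains_of_length (chain_length F)) n"
  using framed_chains_subset[of F n] unfolding cycles_def kernel_def by auto

lemma boundaries_coset: "boundaries P n #>\<^bsub>chain_group P n\<^esub> z = {b + z |b. b \<in> boundaries P n}"
  by (auto simp: r_coset_def)

lemma boundaries_coset_absorb:
  assumes "b \<in> boundaries P n"
  shows "boundaries P n #>\<^bsub>chain_group P n\<^esub> (b + z) = boundaries P n #>\<^bsub>chain_group P n\<^esub> z"
proof -
  have "c + (b + z) \<in> {d + z |d. d \<in> boundaries P n}" if "c \<in> boundaries P n" for c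
    unfolding add.assoc[symmetric] using boundaries_add[OF that assms] by blast
  moreover have "c + z \<in> {d + (b + z) |d. d \<in> boundaries P n}" if "c \<in> boundaries P n" for c
  proof -
    have "c + z = (c - b) + (b + z)" by (simp add: algebra_simps)
    then show ?thesis using boundaries_diff[OF that assms] by blast
  qed
  ultimately show ?thesis unfolding boundaries_coset by blast
qed

lemma natural_map_class:
  fixes F :: "'a::metric_space list"
  defines "Q \<equiv> proper_chains_of_length (chain_length F)"
  shows "natural_map F n (boundaries (framed_chains F) n #>\<^bsub>chain_group (framed_chains F) n\<^esub> z)
           = boundaries Q n #>\<^bsub>chain_group Q n\<^esub> z"
proof -
  let ?cl = "\<lambda>z. boundaries Q n #>\<^bsub>chain_group Q n\<^esub> z"
  let ?C = "boundaries (framed_chains F) n #>\<^bsub>chain_group (framed_chains F) n\<^esub> z"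
  have "0 + z \<in> ?C"
    unfolding boundaries_coset using zero_boundaries by blast
  moreover have "?cl y = ?cl z" if "y \<in> ?C" for y
    using that framed_boundaries_subset boundaries_coset_absorb
    unfolding boundaries_coset[of "framed_chains F"] Q_def by blast
  ultimately have "?cl ` ?C = {?cl z}" by blast
  then show ?thesis by (simp add: natural_map_def Q_def Let_def)
qed

lemma natural_map_hom:
  "natural_map F n \<in> hom (frame_homology F n) (magnitude_homology (chain_length F) n)"
proof -
  let ?P = "framed_chains F" and ?Q = "proper_chains_of_length (chain_length F)"
  have rc: "carrier (chain_homology R n) = 
      {boundaries R n #>\<^bsub>chain_group R n\<^esub> z |z. z \<in> cycles R n}" for R :: "int \<Rightarrow> 'a list set"
    by (auto simp: chain_homology_def FactGroup_def RCOSETS_def r_coset_def)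
  have mult: "(boundaries R n #>\<^bsub>chain_group R n\<^esub> y) \<otimes>\<^bsub>chain_homology R n\<^esub>
        (boundaries R n #>\<^bsub>chain_group R n\<^esub> z) = boundaries R n #>\<^bsub>chain_group R n\<^esub> (y + z)"
    for R :: "int \<Rightarrow> 'a list set" and y z
  proof -
    have eq: "(a + y) + (b + z) = (a + b) + (y + z)" "a + (y + z) = (a + y) + (0 + z)" for a b
      by (simp_all add: algebra_simps)
    have "(boundaries R n #>\<^bsub>chain_group R n\<^esub> y) \<otimes>\<^bsub>chain_homology R n\<^esub>
        (boundaries R n #>\<^bsub>chain_group R n\<^esub> z) =
        {(a + y) + (b + z) |a b. a \<in> boundaries R n \<and> b \<in> boundaries R n}"
      by (auto simp: chain_homology_def FactGroup_def set_mult_def r_coset_def)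
    also have "\<dots> = {a + (y + z) |a. a \<in> boundaries R n}"
    proof (intro equalityI subsetI)
      fix x assume "x \<in> {(a + y) + (b + z) |a b. a \<in> boundaries R n \<and> b \<in> boundaries R n}"
      then show "x \<in> {a + (y + z) |a. a \<in> boundaries R n}"
        unfolding eq(1) using boundaries_add[of _ R n] by blast
    next
      fix x assume "x \<in> {a + (y + z) |a. a \<in> boundaries R n}"
      then show "x \<in> {(a + y) + (b + z) |a b. a \<in> boundaries R n \<and> b \<in> boundaries R n}"
        unfolding eq(2) using zero_boundaries[of R n] by blast
    qed
    finally show ?thesis by (simp add: boundaries_coset)
  qed
  show ?thesis
    unfolding frame_homology_def magnitude_homology_def
  proof (rule homI)
    fix C assume "C \<in> carrier (chain_homology ?P n)"
    then show "natural_map F n C \<in> carrier (chain_homology ?Q n)"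
      using framed_cycles_subset[of F n] unfolding rc by (auto simp only: natural_map_class)
  next
    fix C D assume "C \<in> carrier (chain_homology ?P n)" "D \<in> carrier (chain_homology ?P n)"
    then show "natural_map F n (C \<otimes>\<^bsub>chain_homology ?P n\<^esub> D) =
        natural_map F n C \<otimes>\<^bsub>chain_homology ?Q n\<^esub> natural_map F n D"
      by (auto simp: rc mult natural_map_class)
  qed
qed

end

theory Submission
  imports Defs
begin

(* A chain of length d(a0, a1) from a0 to a1 is geodesic, so all its interior points are smooth; hence
   the chains framed by (a0, a1) are exactly the chains of that length with these end points. Removing
   a smooth point keeps the end points, so discarding all other chains is a chain map that retracts
   the magnitude complex onto the framed one, and a retract injects in homology. *)

text \<open>The triangle inequality, iterated. Index \<open>k\<close> stands for the edge from
  position \<open>k - 1\<close> to \<open>k\<close>, so the edges between \<open>i\<close> and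
  \<open>j\<close> are \<open>Suc i..<Suc j\<close>.\<close>

lemma dist_nth_le_sum:
  fixes xs :: "'a::metric_space list"
  assumes "i \<le> j"
  shows "dist (xs ! i) (xs ! j) \<le> (\<Sum>k = Suc i..<Suc j. dist (xs ! (k - 1)) (xs ! k))"
  using assms
proof (induction j rule: dec_induct)
  case base
  show ?case by simp
next
  case (step j)
  have "dist (xs ! i) (xs ! Suc j) \<le> dist (xs ! i) (xs ! j) + dist (xs ! j) (xs ! Suc j)"
    by (rule dist_triangle)
  then show ?case
    using step by simp
qed

text \<open>If the triangle inequality at position \<open>i\<close> were strict, skipping that point
  would give a path shorter than the distance between its ends.\<close>

lemma smooth_at_geodesic:
  fixes xs :: "'a::metric_space list"
  assumes proper: "xs \<in> proper_chains n"
    and len: "chain_length xs \<le> dist (hd xs) (last xs)"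
    and i: "1 \<le> i" "i + 1 < length xs"
  shows "smooth_at xs i"
proof -
  let ?d = "\<lambda>k. dist (xs ! (k - 1)) (xs ! k)"
  have "xs \<noteq> []" using i by auto
  then have ends: "hd xs = xs ! 0" "last xs = xs ! (length xs - 1)"
    by (simp_all add: hd_conv_nth last_conv_nth)
  \<comment> \<open>Only the two edges meeting at \<open>i\<close> are kept exactly; the blocks
    before and after them are bounded below by the distances they span.\<close>
  have "chain_length xs = sum ?d {1..<i} + sum ?d {i..<i+2} + sum ?d {i+2..<length xs}"
    unfolding chain_length_def
    using i sum.atLeastLessThan_concat[of 1 i "i + 2" ?d]
      sum.atLeastLessThan_concat[of 1 "i + 2" "length xs" ?d] by linarith
  moreover have "sum ?d {i..<i+2} = dist (xs ! (i - 1)) (xs ! i) + dist (xs ! i) (xs ! (i + 1))"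
    by simp
  moreover have "dist (xs ! 0) (xs ! (i - 1)) \<le> sum ?d {1..<i}"
    using dist_nth_le_sum[of 0 "i - 1" xs] i by simp
  moreover have "dist (xs ! (i + 1)) (xs ! (length xs - 1)) \<le> sum ?d {i+2..<length xs}"
    using dist_nth_le_sum[of "i + 1" "length xs - 1" xs] i \<open>xs \<noteq> []\<close> by (simp del: sum.op_ivl_Suc)
  moreover have "dist (xs ! 0) (xs ! (length xs - 1)) \<le>
      dist (xs ! 0) (xs ! (i - 1)) + dist (xs ! (i - 1)) (xs ! (i + 1))
        + dist (xs ! (i + 1)) (xs ! (length xs - 1))"
    using dist_triangle[of "xs ! 0" "xs ! (length xs - 1)" "xs ! (i - 1)"]
      dist_triangle[of "xs ! (i - 1)" "xs ! (length xs - 1)" "xs ! (i + 1)"] by linarith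
  moreover have "dist (xs ! (i - 1)) (xs ! (i + 1)) \<le>
      dist (xs ! (i - 1)) (xs ! i) + dist (xs ! i) (xs ! (i + 1))"
    by (rule dist_triangle)
  ultimately have "dist (xs ! (i - 1)) (xs ! i) + dist (xs ! i) (xs ! (i + 1)) =
      dist (xs ! (i - 1)) (xs ! (i + 1))"
    using len unfolding ends by linarith
  moreover have "xs ! (j - 1) \<noteq> xs ! j" if "1 \<le> j" "j < length xs" for j
    using proper that by (simp add: proper_chains_def)
  from this[of i] this[of "i + 1"] have "xs ! (i - 1) \<noteq> xs ! i" "xs ! i \<noteq> xs ! (i + 1)"
    using i by simp_all
  ultimately show ?thesis
    using i by (simp add: smooth_at_def strictly_between_def)
qed

lemma not_smooth_at_ends [simp]: "\<not> smooth_at xs 0" "\<not> smooth_at xs (length xs - 1)"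
  by (auto simp: smooth_at_def)

lemma chain_frame_ends:
  assumes "xs \<noteq> []"
  shows "hd (chain_frame xs) = hd xs" "last (chain_frame xs) = last xs"
proof -
  obtain y ys where "xs = y # ys" using assms by (cases xs) auto
  then show "hd (chain_frame xs) = hd xs"
    by (simp add: chain_frame_def nths_Cons)
next
  obtain y ys where "xs = ys @ [y]" using assms by (cases xs rule: rev_cases) auto
  then show "last (chain_frame xs) = last xs"
    using not_smooth_at_ends(2)[of xs] by (simp add: chain_frame_def nths_append)
qed

text \<open>Every interior point is smooth, so only the ends survive. They occupy two different
  positions because \<open>2 \<le> length xs\<close>; the frame of a one-point chain has a single
  entry.\<close>

lemma chain_frame_geodesic:
  assumes "xs \<in> proper_chains n" "chain_length xs \<le> dist (hd xs) (last xs)" "2 \<le> length xs"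
  shows "chain_frame xs = [hd xs, last xs]"
proof -
  obtain y ys z where xs: "xs = y # ys @ [z]"
    using assms(3) by (cases xs; cases "tl xs" rule: rev_cases) auto
  have "smooth_at xs (Suc j)" if "j < length ys" for j
    using smooth_at_geodesic[OF assms(1,2), of "Suc j"] that xs by simp
  \<comment> \<open>\<open>nths_Cons\<close> shifts the index set: position \<open>j\<close> of
    \<open>ys\<close> is position \<open>Suc j\<close> of \<open>xs\<close>.\<close>
  then have "nths ys {j. \<not> smooth_at xs (Suc j)} = []"
    by (auto simp: set_nths simp flip: set_empty)
  moreover have "\<not> smooth_at xs 0" "\<not> smooth_at xs (Suc (length ys))"
    using not_smooth_at_ends[of xs] xs by simp_all
  ultimately have "nths (y # ys @ [z]) {i. \<not> smooth_at xs i} = [y, z]"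
    by (simp add: nths_Cons nths_append)
  then show ?thesis
    unfolding chain_frame_def using xs by simp
qed

text \<open>Trades the frame condition for one on the end points, which faces visibly
  preserve.\<close>

lemma framed_chains_pair:
  assumes "a \<noteq> b"
  shows "framed_chains [a, b] n =
    {xs \<in> proper_chains_of_length (dist a b) n. hd xs = a \<and> last xs = b}"
proof (intro equalityI subsetI CollectI conjI)
  fix xs assume "xs \<in> framed_chains [a, b] n"
  then have "xs \<in> proper_chains_of_length (dist a b) n" "xs \<noteq> []" "chain_frame xs = [a, b]"
    by (auto simp: framed_chains_def proper_chains_of_length_def proper_chains_def)
  then show "xs \<in> proper_chains_of_length (dist a b) n" "hd xs = a" "last xs = b"
    using chain_frame_ends[of xs] by auto
next
  fix xs assume "xs \<in> {xs \<in> proper_chains_of_length (dist a b) n. hd xs = a \<and> last xs = b}"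
  then have xs: "xs \<in> proper_chains n" "chain_length xs = dist a b" "hd xs = a" "last xs = b"
    by (auto simp: proper_chains_of_length_def)
  \<comment> \<open>A one-point chain would force \<open>a = b\<close>.\<close>
  have "2 \<le> length xs"
    using xs assms by (cases xs; cases "tl xs") (auto simp: proper_chains_def)
  then show "xs \<in> framed_chains [a, b] n"
    using chain_frame_geodesic[of xs n] xs by (simp add: framed_chains_def proper_chains_of_length_def)
qed

text \<open>The retraction, defined on all formal sums at once. Degree and length need not be
  mentioned, since each basis chain is either kept or sent to 0.\<close>

definition endpoint_projection :: "'a \<Rightarrow> 'a \<Rightarrow> ('a list \<Rightarrow>\<^sub>0 int) \<Rightarrow> ('a list \<Rightarrow>\<^sub>0 int)" where
  "endpoint_projection a b =
     frag_extend (\<lambda>xs. if hd xs = a \<and> last xs = b then frag_of xs else 0)"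

lemma keys_endpoint_projection:
  "Poly_Mapping.keys (endpoint_projection a b c) \<subseteq>
     {xs \<in> Poly_Mapping.keys c. hd xs = a \<and> last xs = b}"
  unfolding endpoint_projection_def
  by (rule order_trans[OF keys_frag_extend]) (auto split: if_splits)

lemma endpoint_projection_id:
  assumes "\<And>xs. xs \<in> Poly_Mapping.keys c \<Longrightarrow> hd xs = a \<and> last xs = b"
  shows "endpoint_projection a b c = c"
proof -
  have "endpoint_projection a b c = frag_extend frag_of c"
    unfolding endpoint_projection_def by (rule frag_extend_eq) (simp add: assms)
  then show ?thesis by (simp add: frag_expansion[symmetric])
qed

text \<open>A smooth position is interior, so deleting it changes neither end; at any other position
  both sides are 0.\<close>

lemma endpoint_projection_face:
  "endpoint_projection a b (magnitude_face i xs) =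
     (if hd xs = a \<and> last xs = b then magnitude_face i xs else 0)"
proof (cases "smooth_at xs i")
  case True
  then have "hd (take i xs @ drop (i + 1) xs) = hd xs" "last (take i xs @ drop (i + 1) xs) = last xs"
    by (auto simp: smooth_at_def hd_append)
  with True show ?thesis
    by (simp add: magnitude_face_def endpoint_projection_def)
qed (simp add: magnitude_face_def endpoint_projection_def)

lemma endpoint_projection_boundary:
  "endpoint_projection a b (magnitude_boundary c) = magnitude_boundary (endpoint_projection a b c)"
  using subset_UNIV
proof (induction c rule: frag_induction)
  case (one xs)
  let ?s = "\<lambda>xs. \<Sum>i<length xs. frag_cmul ((-1) ^ i) (magnitude_face i xs)"
  have "endpoint_projection a b (?s xs) =
      (\<Sum>i<length xs. frag_cmul ((-1) ^ i) (endpoint_projection a b (magnitude_face i xs)))"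
    by (simp add: endpoint_projection_def frag_extend_sum frag_extend_cmul o_def)
  \<comment> \<open>The condition does not depend on \<open>i\<close>, so it can be decided outside
    the sum.\<close>
  also have "\<dots> = (if hd xs = a \<and> last xs = b then ?s xs else 0)"
    unfolding endpoint_projection_face by (cases "hd xs = a \<and> last xs = b")
      (simp_all only: simp_thms if_True if_False frag_cmul_zero2 sum.neutral_const)
  also have "\<dots> = magnitude_boundary (endpoint_projection a b (frag_of xs))"
    by (simp add: magnitude_boundary_def endpoint_projection_def)
  finally show ?case
    by (simp add: magnitude_boundary_def)
qed (simp_all add: endpoint_projection_def magnitude_boundary_def frag_extend_diff)

text \<open>If \<open>c\<close> bounds \<open>e\<close>, then it also bounds the projection of
  \<open>e\<close>: projection commutes with the boundary and fixes \<open>c\<close>.\<close>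

lemma framed_boundaries_pair:
  assumes "a \<noteq> b" "c \<in> boundaries (proper_chains_of_length (dist a b)) n"
    and "\<And>xs. xs \<in> Poly_Mapping.keys c \<Longrightarrow> hd xs = a \<and> last xs = b"
  shows "c \<in> boundaries (framed_chains [a, b]) n"
proof -
  obtain e where e: "Poly_Mapping.keys e \<subseteq> proper_chains_of_length (dist a b) (n + 1)"
    "c = magnitude_boundary e"
    using assms(2) unfolding boundaries_def by auto
  have "c = magnitude_boundary (endpoint_projection a b e)"
    using endpoint_projection_id[OF assms(3)] e(2) endpoint_projection_boundary[of a b e] by simp
  moreover have "endpoint_projection a b e \<in> carrier (chain_group (framed_chains [a, b]) (n + 1))"
    using keys_endpoint_projection[of a b e] e(1)
    unfolding framed_chains_pair[OF assms(1)] carrier_free_Abelian_group_iff by blast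
  ultimately show ?thesis unfolding boundaries_def by (rule image_eqI)
qed

theorem theorem5p11:
  fixes a0 a1 :: "'a::metric_space" and F :: "'a list" and l :: real and n :: int
  assumes "F = [a0, a1]"
    and "l = chain_length F"
    and "l > 0"
  shows "natural_map F n \<in> mon (frame_homology F n) (magnitude_homology l n)"
proof -
  let ?P = "framed_chains F" and ?Q = "proper_chains_of_length l"
  \<comment> \<open>Positivity of \<open>l\<close> enters here: it makes the two end points
    distinct.\<close>
  have ne: "a0 \<noteq> a1" and l: "l = dist a0 a1" using assms by auto
  have "C = D"
    if CD: "C \<in> carrier (frame_homology F n)" "D \<in> carrier (frame_homology F n)"
      and eq: "natural_map F n C = natural_map F n D" for C D
  proof -
    obtain y z where y: "y \<in> cycles ?P n" "C = boundaries ?P n #>\<^bsub>chain_group ?P n\<^esub> y"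
      and z: "z \<in> cycles ?P n" "D = boundaries ?P n #>\<^bsub>chain_group ?P n\<^esub> z"
      using CD by (auto simp: frame_homology_def chain_homology_def FactGroup_def RCOSETS_def r_coset_def)
    have "boundaries ?Q n #>\<^bsub>chain_group ?Q n\<^esub> y = boundaries ?Q n #>\<^bsub>chain_group ?Q n\<^esub> z"
      using eq unfolding y(2) z(2) natural_map_class assms(2) .
    \<comment> \<open>As 0 is a boundary, \<open>y\<close> lies in its own coset, hence in that of
      \<open>z\<close>; this yields the boundary \<open>b = y - z\<close> of the large
      complex.\<close>
    moreover have "0 + y \<in> boundaries ?Q n #>\<^bsub>chain_group ?Q n\<^esub> y"
      unfolding boundaries_coset using zero_boundaries by blast
    ultimately obtain b where b: "b \<in> boundaries ?Q n" "y = b + z"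
      unfolding boundaries_coset by auto
    \<comment> \<open>As a difference of framed cycles, \<open>b\<close> is supported on framed
      chains, so its filling can be projected.\<close>
    have "Poly_Mapping.keys y \<subseteq> ?P n" "Poly_Mapping.keys z \<subseteq> ?P n"
      using y(1) z(1) by (auto simp: cycles_def kernel_def)
    then have "Poly_Mapping.keys b \<subseteq> ?P n"
      using keys_diff[of y z] b(2) by auto
    then have "b \<in> boundaries ?P n"
      using framed_boundaries_pair[OF ne b(1)[unfolded l]]
      unfolding assms(1) framed_chains_pair[OF ne] by blast
    then show ?thesis
      unfolding y(2) z(2) b(2) by (rule boundaries_coset_absorb)
  qed
  then show ?thesis
    using natural_map_hom[of F n] by (auto simp: mon_def inj_on_def assms(2))
qed

end
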